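(* Let $H_\nu^N$ be the family of integrals described in the context. Then for all $z>0$, \[ H^{N+1}_{\nu+1}(z)=\frac{\nu}{z}H^N_\nu(z)-\frac{d}{dz} H^N_\nu(z). \]
   Context: Let $N\in\mathbb{R}$, $\nu\in\mathbb{C}$, let $-\infty\le t_i<t_f\le\infty$, let $r:(t_i,t_f)\to(0,\infty)$ and $w:(t_i,t_f)\to\mathbb{C}$ be functions, and let $C_\nu, C_{\nu+1}:(0,\infty)\to\mathbb{C}$. Define for $z>0$ (and likewise with other values of $N$ and with $\nu+1$ in place of $\nu$) \[ H_\nu^N(z)=\int_{t_i}^{t_f} r(t)^N\, C_\nu(z\,r(t))\, w(t)\,dt . \] Assumptions: (i) the integrals $H_\nu^N$, $H_\nu^{N+2}$, $H_{\nu+1}^{N+1}$ are defined in the $L^1$ sense (the integrands are absolutely integrable for each $z>0$); (ii) differentiation in $z$ commutes with the integral, i.e. $H_\nu^N$ is twice differentiable on $(0,\infty)$ and its first and second derivatives are given by (absolutely convergent) integrals obtained by differentiating the integrand in $z$; (iii) $C_\nu$ is a solution on $(0,\infty)$ of the Bessel equation (upper sign) or of the modified Bessel equation (lower sign) \[ z^2\frac{d^2C_\nu(z)}{dz^2}+z\frac{dC_\nu(z)}{dz}=(\nu^2\mp z^2)\,C_\nu(z); \] (iv) $\frac{d}{dz}\left[z^{-\nu}C_\nu(z)\right]=-z^{-\nu}C_{\nu+1}(z)$ for $z>0$. *)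

theory Defs
  imports "HOL-Analysis.Analysis"
begin

text \<open>
  The functions \<open>C\<^sub>\<nu>\<close> and \<open>C\<^sub>\<nu>\<^sub>+\<^sub>1\<close> are the members \<open>C \<nu>\<close> and \<open>C (\<nu> + 1)\<close> of an indexed
  family \<open>C\<close>. Functions on \<open>(t\<^sub>i, t\<^sub>f)\<close> or \<open>(0, \<infinity>)\<close> are total functions on the reals whose
  values elsewhere are never used. Derivatives of complex-valued functions of a real
  variable are vector derivatives.
\<close>

definition H_integrand ::
  "(real \<Rightarrow> real) \<Rightarrow> (real \<Rightarrow> complex) \<Rightarrow> (complex \<Rightarrow> real \<Rightarrow> complex) \<Rightarrow>
    real \<Rightarrow> complex \<Rightarrow> real \<Rightarrow> real \<Rightarrow> complex"
  where "H_integrand r w C N \<nu> z t = of_real (r t powr N) * C \<nu> (z * r t) * w t"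

definition H_integral ::
  "ereal \<Rightarrow> ereal \<Rightarrow> (real \<Rightarrow> real) \<Rightarrow> (real \<Rightarrow> complex) \<Rightarrow> (complex \<Rightarrow> real \<Rightarrow> complex) \<Rightarrow>
    real \<Rightarrow> complex \<Rightarrow> real \<Rightarrow> complex"
  where "H_integral ti tf r w C N \<nu> z =
    (LINT t:einterval ti tf|lebesgue. H_integrand r w C N \<nu> z t)"

definition vderiv :: "(real \<Rightarrow> complex) \<Rightarrow> real \<Rightarrow> complex"
  where "vderiv f x = vector_derivative f (at x)"

text \<open>
  The Bessel equation is the case \<open>s = 1\<close> (upper sign), the modified Bessel equation the
  case \<open>s = -1\<close> (lower sign). Differentiability is stated explicitly because
  \<^const>\<open>vector_derivative\<close> is an unspecified value where no derivative exists.
\<close>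

definition solves_bessel_eq :: "real \<Rightarrow> complex \<Rightarrow> (real \<Rightarrow> complex) \<Rightarrow> bool"
  where "solves_bessel_eq s \<nu> f \<longleftrightarrow>
    (\<forall>z>0. f differentiable (at z) \<and> vderiv f differentiable (at z) \<and>
      of_real (z\<^sup>2) * vderiv (vderiv f) z + of_real z * vderiv f z =
        (\<nu>\<^sup>2 - of_real (s * z\<^sup>2)) * f z)"

end

theory Submission
  imports Defs
begin

text \<open>
  The formula is the integrated form of the recurrence
  \<open>C\<^sub>\<nu>'(x) = (\<nu> / x) C\<^sub>\<nu>(x) - C\<^sub>\<nu>\<^sub>+\<^sub>1(x)\<close>, which is the hypothesis on the derivative of
  \<open>x\<^sup>-\<^sup>\<nu> C\<^sub>\<nu>(x)\<close> with the power cleared (\<open>has_vector_derivative_bessel_recurrence\<close>).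
  Differentiating \<open>C\<^sub>\<nu>(z r(t))\<close> in \<open>z\<close> produces an additional factor \<open>r(t)\<close>. It cancels the
  \<open>r(t)\<close> in the denominator of \<open>\<nu> / (z r(t))\<close>, so that the first term keeps the weight
  \<open>r(t)\<^sup>N\<close> and its coefficient \<open>\<nu> / z\<close> no longer depends on \<open>t\<close>; in the second term it raises the
  weight to \<open>r(t)\<^sup>N\<^sup>+\<^sup>1\<close> (\<open>vderiv_H_integrand\<close>). As the derivative of the integral is the
  integral of the derivative, linearity of the integral gives the claim.
\<close>

text \<open>
  Complex powers of a positive real do not vanish, so near \<open>z\<close> the function \<open>f\<close> is the product
  of \<open>x\<^sup>\<nu>\<close> and \<open>x\<^sup>-\<^sup>\<nu> f(x)\<close>, and the product rule yields both that \<open>f\<close> is differentiable and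
  the value of its derivative.
\<close>

lemma has_vector_derivative_bessel_recurrence:
  fixes f :: "real \<Rightarrow> complex" and \<nu> c :: complex
  assumes z: "0 < z"
    and deriv: "((\<lambda>x. of_real x powr (-\<nu>) * f x) has_vector_derivative
      - (of_real z powr (-\<nu>) * c)) (at z)"
  shows "(f has_vector_derivative \<nu> / of_real z * f z - c) (at z)"
proof -
  have cancel: "of_real x powr \<nu> * (of_real x powr (-\<nu>) * y) = y" if "0 < x" for x :: real and y
    using that by (simp add: powr_minus)
  have "((\<lambda>x. of_real x powr \<nu>) has_vector_derivative \<nu> * of_real z powr (\<nu> - 1)) (at z)"
    using z by (intro has_vector_derivative_real_field has_field_derivative_powr)
      (auto simp: complex_nonpos_Reals_iff)
  then have "((\<lambda>x. of_real x powr \<nu> * (of_real x powr (-\<nu>) * f x)) has_vector_derivative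
      of_real z powr \<nu> * - (of_real z powr (-\<nu>) * c) +
      \<nu> * of_real z powr (\<nu> - 1) * (of_real z powr (-\<nu>) * f z)) (at z)"
    using deriv by (rule has_vector_derivative_mult)
  also have "of_real z powr \<nu> * - (of_real z powr (-\<nu>) * c) +
      \<nu> * of_real z powr (\<nu> - 1) * (of_real z powr (-\<nu>) * f z) = \<nu> / of_real z * f z - c"
    using z by (simp add: powr_diff powr_minus field_simps)
  finally show ?thesis
    by (rule has_vector_derivative_transform_within_open[where S = "{0<..}"])
      (use z cancel in auto)
qed

lemma vderiv_H_integrand:
  assumes z: "0 < z" and r: "0 < r t"
    and deriv: "\<And>x. 0 < x \<Longrightarrow>
      ((\<lambda>x. of_real x powr (-\<nu>) * C \<nu> x) has_vector_derivative
        - (of_real x powr (-\<nu>) * C (\<nu> + 1) x)) (at x)"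
  shows "vderiv (\<lambda>x. H_integrand r w C N \<nu> x t) z =
    \<nu> / of_real z * H_integrand r w C N \<nu> z t - H_integrand r w C (N + 1) (\<nu> + 1) z t"
proof -
  let ?d = "\<nu> / of_real (z * r t) * C \<nu> (z * r t) - C (\<nu> + 1) (z * r t)"
  have "0 < z * r t" using z r by simp
  then have C': "(C \<nu> has_vector_derivative ?d) (at (z * r t))"
    by (intro has_vector_derivative_bessel_recurrence deriv)
  have "((\<lambda>x. x * r t) has_vector_derivative r t) (at z)"
    by (auto intro!: derivative_eq_intros)
  from vector_diff_chain_at[OF this C']
  have "((\<lambda>x. C \<nu> (x * r t)) has_vector_derivative of_real (r t) * ?d) (at z)"
    by (simp add: o_def scaleR_conv_of_real)
  then have "((\<lambda>x. H_integrand r w C N \<nu> x t) has_vector_derivative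
      of_real (r t powr N) * (of_real (r t) * ?d) * w t) (at z)"
    unfolding H_integrand_def
    by (intro has_vector_derivative_mult_left has_vector_derivative_mult_right)
  then have "vderiv (\<lambda>x. H_integrand r w C N \<nu> x t) z =
      of_real (r t powr N) * (of_real (r t) * ?d) * w t"
    unfolding vderiv_def by (rule vector_derivative_at)
  also have "\<dots> = \<nu> / of_real z * H_integrand r w C N \<nu> z t - H_integrand r w C (N + 1) (\<nu> + 1) z t"
    using z r by (simp add: H_integrand_def powr_add field_simps)
  finally show ?thesis .
qed

theorem lemma3p2:
  fixes N :: real and \<nu> :: complex and ti tf :: ereal
    and r :: "real \<Rightarrow> real" and w :: "real \<Rightarrow> complex"
    and C :: "complex \<Rightarrow> real \<Rightarrow> complex"
  assumes "ti < tf"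
    and "\<And>t. t \<in> einterval ti tf \<Longrightarrow> 0 < r t"
    and "\<And>z. 0 < z \<Longrightarrow> H_integrand r w C N \<nu> z absolutely_integrable_on einterval ti tf"
    and "\<And>z. 0 < z \<Longrightarrow> H_integrand r w C (N + 2) \<nu> z absolutely_integrable_on einterval ti tf"
    and "\<And>z. 0 < z \<Longrightarrow> H_integrand r w C (N + 1) (\<nu> + 1) z absolutely_integrable_on einterval ti tf"
    and "\<And>z. 0 < z \<Longrightarrow>
      (\<lambda>t. vderiv (\<lambda>x. H_integrand r w C N \<nu> x t) z) absolutely_integrable_on einterval ti tf"
    and "\<And>z. 0 < z \<Longrightarrow>
      (H_integral ti tf r w C N \<nu> has_vector_derivative
        (LINT t:einterval ti tf|lebesgue. vderiv (\<lambda>x. H_integrand r w C N \<nu> x t) z)) (at z)"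
    and "\<And>z. 0 < z \<Longrightarrow>
      (\<lambda>t. vderiv (vderiv (\<lambda>x. H_integrand r w C N \<nu> x t)) z)
        absolutely_integrable_on einterval ti tf"
    and "\<And>z. 0 < z \<Longrightarrow>
      (vderiv (H_integral ti tf r w C N \<nu>) has_vector_derivative
        (LINT t:einterval ti tf|lebesgue. vderiv (vderiv (\<lambda>x. H_integrand r w C N \<nu> x t)) z)) (at z)"
    and "solves_bessel_eq 1 \<nu> (C \<nu>) \<or> solves_bessel_eq (-1) \<nu> (C \<nu>)"
    and "\<And>z. 0 < z \<Longrightarrow>
      ((\<lambda>x. of_real x powr (-\<nu>) * C \<nu> x) has_vector_derivative
        - (of_real z powr (-\<nu>) * C (\<nu> + 1) z)) (at z)"
  shows "\<forall>z>0. H_integral ti tf r w C (N + 1) (\<nu> + 1) z =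
    \<nu> / of_real z * H_integral ti tf r w C N \<nu> z - vderiv (H_integral ti tf r w C N \<nu>) z"
proof (intro allI impI)
  fix z :: real
  assume z: "0 < z"
  let ?S = "einterval ti tf"
  have "vderiv (H_integral ti tf r w C N \<nu>) z =
      (LINT t:?S|lebesgue. vderiv (\<lambda>x. H_integrand r w C N \<nu> x t) z)"
    unfolding vderiv_def[of "H_integral ti tf r w C N \<nu>"]
    using assms(7)[OF z] by (rule vector_derivative_at)
  also have "\<dots> = (LINT t:?S|lebesgue. \<nu> / of_real z * H_integrand r w C N \<nu> z t -
      H_integrand r w C (N + 1) (\<nu> + 1) z t)"
    using vderiv_H_integrand[of z r _ \<nu> C, OF z assms(2,11)]
    by (intro set_lebesgue_integral_cong) auto
  also have "\<dots> = \<nu> / of_real z * H_integral ti tf r w C N \<nu> z -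
      H_integral ti tf r w C (N + 1) (\<nu> + 1) z"
    using assms(3,5)[OF z] by (simp add: H_integral_def set_integral_diff)
  finally show "H_integral ti tf r w C (N + 1) (\<nu> + 1) z =
      \<nu> / of_real z * H_integral ti tf r w C N \<nu> z - vderiv (H_integral ti tf r w C N \<nu>) z"
    by simp
qed

end
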